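(* Let $n\ge 1$ be an integer, $\lambda_1,\dots,\lambda_n>0$, $m>0$, $c>0$, $\mu>0$, $\sigma>0$, $\beta\ge 0$, $T>0$, and let $Y$ be a positive random variable with $\mathbb{E}(e^{mY})<+\infty$. For $t\in[0,T]$, $x\in\mathbb{R}$, $s>0$ and $i\in\{1,\dots,n\}$ define $$v(t,x,s,i)=-\frac{1}{m}\exp\left\{-m x+\frac{\mu^2}{2\sigma^2} (t-T)s^{-2\beta}\right\}\psi_i(t),\qquad \psi_i(t)=\varphi_i(t)e^{L(t)},$$ where $$L(t)=\Big(cm+\frac{(2\beta +1)\mu^2 \beta T}{2}\Big) t -\frac{(2\beta +1)\mu^2 \beta}{4}t^2$$ and $$(\varphi_1(t),\dots,\varphi_n(t))^{\top}=e^{\hat{Q}(t-T)}\,(e^{-L(T)},\dots,e^{-L(T)})^{\top},$$ with $\hat Q$ the $n\times n$ matrix described in the context. Then for all $t\in[0,T]$, $s>0$ and $i\in\{1,\dots,n\}$, the function $x\mapsto v(t,x,s,i)$ is concave on $\mathbb{R}$.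
   Context: The matrix $\hat Q$ has entries $\hat Q_{ii}=\lambda_i$ for all $i$, $\hat Q_{i,i+1}=-\lambda_i$ for $1\le i\le n-1$, $\hat Q_{n,1}=-\lambda_n\mathbb{E}(e^{mY})$, and all other entries zero (for $n\ge 2$; in the degenerate case $n=1$, $\hat Q=(\lambda_1-\lambda_1\mathbb{E}(e^{mY}))$). *)

theory Defs
  imports "HOL-Probability.Probability" "Jordan_Normal_Form.Matrix"
begin

(* The library has exp only for Banach algebras, which the type of matrices is not;
   the exponential series is therefore summed entrywise. *)
definition mat_exp :: "real mat \<Rightarrow> real mat" where
  "mat_exp A = mat (dim_row A) (dim_col A)
     (\<lambda>(i, j). \<Sum>k. (A ^\<^sub>m k) $$ (i, j) / fact k)"

(* Matrices and vectors of the library are indexed from 0, hence the shifts by one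
   below; Q_entry and the families lam, phi, psi, v_fun use the indices 1, ..., n. The
   argument e stands for the expectation of exp (m Y). *)
definition Q_entry :: "nat \<Rightarrow> (nat \<Rightarrow> real) \<Rightarrow> real \<Rightarrow> nat \<Rightarrow> nat \<Rightarrow> real" where
  "Q_entry n lam e i j =
     (if n = 1 then lam 1 - lam 1 * e
      else if j = i then lam i
      else if j = i + 1 then - lam i
      else if i = n \<and> j = 1 then - lam n * e
      else 0)"

definition Q_hat :: "nat \<Rightarrow> (nat \<Rightarrow> real) \<Rightarrow> real \<Rightarrow> real mat" where
  "Q_hat n lam e = mat n n (\<lambda>(i, j). Q_entry n lam e (i + 1) (j + 1))"

definition L_fun :: "real \<Rightarrow> real \<Rightarrow> real \<Rightarrow> real \<Rightarrow> real \<Rightarrow> real \<Rightarrow> real" where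
  "L_fun c m \<mu> \<beta> T t =
     (c * m + (2 * \<beta> + 1) * \<mu>\<^sup>2 * \<beta> * T / 2) * t
       - (2 * \<beta> + 1) * \<mu>\<^sup>2 * \<beta> / 4 * t\<^sup>2"

definition phi ::
  "nat \<Rightarrow> (nat \<Rightarrow> real) \<Rightarrow> real \<Rightarrow> real \<Rightarrow> real \<Rightarrow> real \<Rightarrow> real \<Rightarrow> real \<Rightarrow> nat \<Rightarrow> real \<Rightarrow> real" where
  "phi n lam e c m \<mu> \<beta> T i t =
     (mat_exp ((t - T) \<cdot>\<^sub>m Q_hat n lam e) *\<^sub>v
        Matrix.vec n (\<lambda>_. exp (- L_fun c m \<mu> \<beta> T T))) $ (i - 1)"

definition psi ::
  "nat \<Rightarrow> (nat \<Rightarrow> real) \<Rightarrow> real \<Rightarrow> real \<Rightarrow> real \<Rightarrow> real \<Rightarrow> real \<Rightarrow> real \<Rightarrow> nat \<Rightarrow> real \<Rightarrow> real" where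
  "psi n lam e c m \<mu> \<beta> T i t = phi n lam e c m \<mu> \<beta> T i t * exp (L_fun c m \<mu> \<beta> T t)"

definition v_fun ::
  "nat \<Rightarrow> (nat \<Rightarrow> real) \<Rightarrow> real \<Rightarrow> real \<Rightarrow> real \<Rightarrow> real \<Rightarrow> real \<Rightarrow> real \<Rightarrow> real
     \<Rightarrow> real \<Rightarrow> real \<Rightarrow> real \<Rightarrow> nat \<Rightarrow> real" where
  "v_fun n lam e c m \<mu> \<sigma> \<beta> T t x s i =
     - (1 / m) * exp (- m * x + \<mu>\<^sup>2 / (2 * \<sigma>\<^sup>2) * (t - T) * s powr (- 2 * \<beta>))
       * psi n lam e c m \<mu> \<beta> T i t"

end

theory Submission
  imports Defs
begin

text \<open>
  For \<open>t \<le> T\<close> the off-diagonal entries of \<open>(t - T) \<cdot> Q\<close> are nonnegative, so adding a large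
  multiple \<open>a\<close> of the identity gives a matrix \<open>B\<close> with nonnegative entries. Then
  \<open>exp ((t - T) \<cdot> Q) = exp (- a) \<cdot> exp B\<close> is entrywise nonnegative, hence so are \<open>\<phi>\<^sub>i\<close> and
  \<open>\<psi>\<^sub>i\<close>, and \<open>v\<close> is a nonpositive multiple of the exponential of an affine function of \<open>x\<close>.
\<close>

text \<open>The last factor is split off on the right, so the inductions on \<open>k\<close> below
  keep the row \<open>i\<close> fixed and generalise the column \<open>j\<close>.\<close>

lemma pow_mat_Suc_index:
  fixes A :: "'a::semiring_1 mat"
  assumes "A \<in> carrier_mat n n" "i < n" "j < n"
  shows "(A ^\<^sub>m Suc k) $$ (i, j) = (\<Sum>h<n. (A ^\<^sub>m k) $$ (i, h) * A $$ (h, j))"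
proof -
  have "A ^\<^sub>m k \<in> carrier_mat n n"
    using assms by (rule_tac pow_carrier_mat)
  then show ?thesis
    using assms by (simp add: scalar_prod_def atLeast0LessThan)
qed

text \<open>Each further factor turns an entry into a sum of \<open>n\<close> products, which costs
  a factor \<open>n * C\<close>. The crude bound is enough for comparison with an exponential
  series.\<close>

lemma abs_pow_mat_index_le:
  fixes A :: "real mat"
  assumes A: "A \<in> carrier_mat n n"
    and C: "\<And>i j. i < n \<Longrightarrow> j < n \<Longrightarrow> \<bar>A $$ (i, j)\<bar> \<le> C"
    and ij: "i < n" "j < n"
  shows "\<bar>(A ^\<^sub>m k) $$ (i, j)\<bar> \<le> (real n * C) ^ k"
  using ij(2)
proof (induction k arbitrary: j)
  case 0
  then show ?case using A ij(1) by simp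
next
  case (Suc k)
  have "0 \<le> C" using C[OF ij] by linarith
  have "\<bar>(A ^\<^sub>m Suc k) $$ (i, j)\<bar> \<le> (\<Sum>h<n. \<bar>(A ^\<^sub>m k) $$ (i, h)\<bar> * \<bar>A $$ (h, j)\<bar>)"
    unfolding pow_mat_Suc_index[OF A ij(1) Suc.prems] abs_mult[symmetric] by (rule sum_abs)
  also have "\<dots> \<le> (\<Sum>h<n. (real n * C) ^ k * C)"
    using Suc C \<open>0 \<le> C\<close> by (intro sum_mono mult_mono) auto
  also have "\<dots> = (real n * C) ^ Suc k" by simp
  finally show ?case .
qed

lemma pow_mat_index_nonneg:
  fixes B :: "real mat"
  assumes B: "B \<in> carrier_mat n n"
    and nn: "\<And>i j. i < n \<Longrightarrow> j < n \<Longrightarrow> 0 \<le> B $$ (i, j)"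
    and ij: "i < n" "j < n"
  shows "0 \<le> (B ^\<^sub>m k) $$ (i, j)"
  using ij(2)
proof (induction k arbitrary: j)
  case 0
  then show ?case using B ij(1) by simp
next
  case (Suc k)
  then show ?case
    unfolding pow_mat_Suc_index[OF B ij(1) Suc.prems] using nn by (intro sum_nonneg) auto
qed

lemma summable_mat_exp_index:
  fixes A :: "real mat"
  assumes A: "A \<in> carrier_mat n n" and ij: "i < n" "j < n"
  shows "summable (\<lambda>k. norm ((A ^\<^sub>m k) $$ (i, j) / fact k))"
proof -
  \<comment> \<open>Summing all absolute values gives one bound that is valid for every
    entry.\<close>
  define C where "C = (\<Sum>p\<in>{..<n} \<times> {..<n}. \<bar>A $$ p\<bar>)"
  have C: "\<bar>A $$ (p, q)\<bar> \<le> C" if "p < n" "q < n" for p q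
    unfolding C_def by (rule member_le_sum) (use that in auto)
  show ?thesis
  proof (rule summable_comparison_test')
    show "summable (\<lambda>k. (real n * C) ^ k / fact k)"
      using summable_exp_generic[of "real n * C"] by (simp add: divide_inverse mult.commute)
    show "norm (norm ((A ^\<^sub>m k) $$ (i, j) / fact k)) \<le> (real n * C) ^ k / fact k" for k
      using abs_pow_mat_index_le[OF A C ij] by (simp add: divide_right_mono)
  qed
qed

text \<open>The binomial theorem for \<open>(A + a 1)\<^sup>k\<close>, divided by \<open>k!\<close> as needed for the Cauchy product.\<close>

lemma pow_mat_add_smult_one_index:
  fixes A :: "real mat"
  assumes A: "A \<in> carrier_mat n n" and ij: "i < n" "j < n"
  shows "((A + a \<cdot>\<^sub>m 1\<^sub>m n) ^\<^sub>m k) $$ (i, j) / fact k =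
    (\<Sum>l\<le>k. ((A ^\<^sub>m l) $$ (i, j) / fact l) * (a ^ (k - l) / fact (k - l)))"
proof -
  let ?B = "A + a \<cdot>\<^sub>m 1\<^sub>m n"
  have B: "?B \<in> carrier_mat n n" using A by simp
  have "(?B ^\<^sub>m k) $$ (i, j) = (\<Sum>l\<le>k. real (k choose l) * (a ^ (k - l) * (A ^\<^sub>m l) $$ (i, j)))"
    using ij(2)
  proof (induction k arbitrary: j)
    case 0
    then show ?case using A ij(1) by simp
  next
    case (Suc k)
    \<comment> \<open>These are the terms for exponent \<open>Suc k\<close>: a factor
      \<open>a\<close> keeps \<open>l\<close>, a factor \<open>A\<close> on the right raises it by
      one.\<close>
    let ?f = "\<lambda>l. a ^ (Suc k - l) * (A ^\<^sub>m l) $$ (i, j)"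
    have "(?B ^\<^sub>m Suc k) $$ (i, j)
        = (\<Sum>h<n. (?B ^\<^sub>m k) $$ (i, h) * A $$ (h, j))
          + (\<Sum>h<n. if h = j then (?B ^\<^sub>m k) $$ (i, h) * a else 0)"
      unfolding pow_mat_Suc_index[OF B ij(1) Suc.prems] sum.distrib[symmetric]
      using A Suc.prems by (intro sum.cong) (auto simp: algebra_simps)
    also have "(\<Sum>h<n. if h = j then (?B ^\<^sub>m k) $$ (i, h) * a else 0) = a * (?B ^\<^sub>m k) $$ (i, j)"
      using Suc.prems by (simp add: sum.delta)
    also have "\<dots> = (\<Sum>l\<le>k. real (k choose l) * ?f l)"
      unfolding Suc.IH[OF Suc.prems] sum_distrib_left
      by (intro sum.cong) (auto simp: Suc_diff_le)
    also have "(\<Sum>h<n. (?B ^\<^sub>m k) $$ (i, h) * A $$ (h, j))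
        = (\<Sum>h<n. \<Sum>l\<le>k. real (k choose l) * (a ^ (k - l) * (A ^\<^sub>m l) $$ (i, h)) * A $$ (h, j))"
      using Suc.IH by (simp add: sum_distrib_right)
    also have "\<dots> = (\<Sum>l\<le>k. real (k choose l) * ?f (Suc l))"
      unfolding pow_mat_Suc_index[OF A ij(1) Suc.prems]
      by (subst sum.swap) (simp add: sum_distrib_left mult.assoc)
    finally have "(?B ^\<^sub>m Suc k) $$ (i, j)
        = (\<Sum>l\<le>k. real (k choose l) * ?f (Suc l)) + (\<Sum>l\<le>k. real (k choose l) * ?f l)" .
    \<comment> \<open>The added term vanishes, as \<open>k choose Suc k\<close> is 0. Splitting off
      \<open>l = 0\<close> then aligns both sums for Pascal's rule.\<close>
    also have "(\<Sum>l\<le>k. real (k choose l) * ?f l) = (\<Sum>l\<le>Suc k. real (k choose l) * ?f l)"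
      by simp
    also have "(\<Sum>l\<le>k. real (k choose l) * ?f (Suc l)) + \<dots>
        = (\<Sum>l\<le>Suc k. real (Suc k choose l) * ?f l)"
      unfolding sum.atMost_Suc_shift by (simp add: sum.distrib[symmetric] ring_distribs)
    finally show ?case .
  qed
  then show ?thesis
    by (simp add: sum_divide_distrib binomial_fact mult.commute)
qed

text \<open>By the binomial formula above, the left series is the Cauchy product of the entry's
  series for \<open>A\<close> with the scalar series of \<open>exp a\<close>; both converge
  absolutely.\<close>

lemma mat_exp_add_smult_one_index:
  fixes A :: "real mat"
  assumes A: "A \<in> carrier_mat n n" and ij: "i < n" "j < n"
  shows "mat_exp (A + a \<cdot>\<^sub>m 1\<^sub>m n) $$ (i, j) = exp a * mat_exp A $$ (i, j)"
proof -
  have eq: "exp a = (\<Sum>k. a ^ k / fact k)"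
    by (simp add: exp_def divide_inverse mult.commute)
  have sum: "summable (\<lambda>k. norm (a ^ k / fact k))"
    using summable_norm_exp[of a] by (simp add: divide_inverse mult.commute)
  have "mat_exp A $$ (i, j) * exp a
      = (\<Sum>k. \<Sum>l\<le>k. ((A ^\<^sub>m l) $$ (i, j) / fact l) * (a ^ (k - l) / fact (k - l)))"
    using A ij Cauchy_product[OF summable_mat_exp_index[OF A ij] sum]
    by (simp add: mat_exp_def eq)
  also have "\<dots> = mat_exp (A + a \<cdot>\<^sub>m 1\<^sub>m n) $$ (i, j)"
    using A ij unfolding pow_mat_add_smult_one_index[OF A ij, symmetric] by (simp add: mat_exp_def)
  finally show ?thesis by (metis mult.commute)
qed

lemma mat_exp_index_nonneg:
  fixes A :: "real mat"
  assumes A: "A \<in> carrier_mat n n"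
    and off: "\<And>i j. i < n \<Longrightarrow> j < n \<Longrightarrow> i \<noteq> j \<Longrightarrow> 0 \<le> A $$ (i, j)"
    and ij: "i < n" "j < n"
  shows "0 \<le> mat_exp A $$ (i, j)"
proof -
  \<comment> \<open>This shift outweighs every negative diagonal entry and leaves the off-diagonal
    entries unchanged.\<close>
  define a where "a = (\<Sum>h<n. \<bar>A $$ (h, h)\<bar>)"
  let ?B = "A + a \<cdot>\<^sub>m 1\<^sub>m n"
  have B: "?B \<in> carrier_mat n n" using A by simp
  have diag: "- A $$ (h, h) \<le> a" if "h < n" for h
    using member_le_sum[of h "{..<n}" "\<lambda>h. \<bar>A $$ (h, h)\<bar>"] that by (simp add: a_def)
  have "0 \<le> ?B $$ (p, q)" if "p < n" "q < n" for p q
    using A off[OF that] diag[of p] that by (cases "p = q") auto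
  then have "0 \<le> (?B ^\<^sub>m k) $$ (i, j)" for k
    using pow_mat_index_nonneg[OF B _ ij] by blast
  moreover have "summable (\<lambda>k. (?B ^\<^sub>m k) $$ (i, j) / fact k)"
    using summable_mat_exp_index[OF B ij] by (rule summable_norm_cancel)
  ultimately have "0 \<le> mat_exp ?B $$ (i, j)"
    using A ij by (simp add: mat_exp_def suminf_nonneg)
  then show ?thesis
    by (simp add: mat_exp_add_smult_one_index[OF A ij] zero_le_mult_iff)
qed

text \<open>The off-diagonal entries of \<open>Q_hat\<close> are nonpositive and
  \<open>t - T \<le> 0\<close> reverses their sign. The resulting nonnegative exponential acts on a
  vector with positive entries.\<close>

lemma phi_nonneg:
  assumes lam: "\<forall>i\<in>{1..n}. 0 < lam i" and "0 \<le> e" and "t \<le> T" and i: "i \<in> {1..n}"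
  shows "0 \<le> phi n lam e c m \<mu> \<beta> T i t"
proof -
  let ?A = "(t - T) \<cdot>\<^sub>m Q_hat n lam e"
  have A: "?A \<in> carrier_mat n n" by (simp add: Q_hat_def)
  have "0 \<le> ?A $$ (p, q)" if "p < n" "q < n" "p \<noteq> q" for p q
  proof -
    \<comment> \<open>The first rate governs the superdiagonal, the second the corner entry.
      Distinct \<open>p\<close> and \<open>q\<close> rule out \<open>n = 1\<close>.\<close>
    have "0 < lam (p + 1)" "0 < lam n" using lam that by auto
    then have "Q_entry n lam e (p + 1) (q + 1) \<le> 0"
      using \<open>0 \<le> e\<close> that by (auto simp: Q_entry_def)
    then show ?thesis
      using \<open>t \<le> T\<close> that by (simp add: Q_hat_def mult_nonpos_nonpos)
  qed
  then have "0 \<le> mat_exp ?A $$ (i - 1, j)" if "j < n" for j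
    using mat_exp_index_nonneg[OF A] i that by auto
  moreover have "mat_exp ?A \<in> carrier_mat n n"
    by (intro carrier_matI) (simp_all add: mat_exp_def Q_hat_def)
  ultimately show ?thesis
    using i by (auto simp: phi_def scalar_prod_def intro!: sum_nonneg)
qed

theorem lemma3p2:
  fixes n :: nat and lam :: "nat \<Rightarrow> real" and m c \<mu> \<sigma> \<beta> T :: real
    and M :: "'a measure" and Y :: "'a \<Rightarrow> real"
  assumes "n \<ge> 1"
    and "\<forall>i\<in>{1..n}. lam i > 0"
    and "m > 0" and "c > 0" and "\<mu> > 0" and "\<sigma> > 0" and "\<beta> \<ge> 0" and "T > 0"
    and "prob_space M"
    and "Y \<in> borel_measurable M"
    and "AE \<omega> in M. Y \<omega> > 0"
    and "integrable M (\<lambda>\<omega>. exp (m * Y \<omega>))"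
  shows "\<forall>t\<in>{0..T}. \<forall>s>0. \<forall>i\<in>{1..n}.
    concave_on UNIV
      (\<lambda>x. v_fun n lam (prob_space.expectation M (\<lambda>\<omega>. exp (m * Y \<omega>))) c m \<mu> \<sigma> \<beta> T t x s i)"
proof (intro ballI allI impI)
  fix t s :: real and i
  assume t: "t \<in> {0..T}" and i: "i \<in> {1..n}"
  let ?e = "prob_space.expectation M (\<lambda>\<omega>. exp (m * Y \<omega>))"
  \<comment> \<open>With \<open>K\<close> and \<open>P\<close> free of \<open>x\<close>, the
    function in question is \<open>- (P * exp (- m * x + K))\<close>.\<close>
  define K where "K = \<mu>\<^sup>2 / (2 * \<sigma>\<^sup>2) * (t - T) * s powr (- 2 * \<beta>)"
  define P where "P = psi n lam ?e c m \<mu> \<beta> T i t / m"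
  have "0 \<le> ?e" by simp
  then have "0 \<le> P"
    using phi_nonneg[OF assms(2)] t i \<open>m > 0\<close> by (simp add: P_def psi_def)
  moreover have "convex_on UNIV (\<lambda>x. exp (- m * x + K))"
    by (rule f''_ge0_imp_convex[where f' = "\<lambda>x. - m * exp (- m * x + K)"
          and f'' = "\<lambda>x. m\<^sup>2 * exp (- m * x + K)"])
      (auto intro!: derivative_eq_intros simp: power2_eq_square)
  ultimately have "convex_on UNIV (\<lambda>x. P * exp (- m * x + K))"
    by (rule convex_on_cmul)
  then show "concave_on UNIV (\<lambda>x. v_fun n lam ?e c m \<mu> \<sigma> \<beta> T t x s i)"
    by (simp add: concave_on_def v_fun_def K_def P_def mult.commute)
qed

end
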